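(* Let $\mathcal{G}$ be a finite group acting by permutations on a finite set $\mathcal{X}$ with $\#\mathcal{X}=n$, let $\omega\ge 1$, and let $\mathcal{F}_\omega:\mathbb{R}[\mathcal{X}^{\times\omega}]\to\mathbb{R}^{\kappa_\omega}$ be the linear $\mathcal{G}$-invariant defined in the context. Let $\mathcal{R}$ be any fundamental region. Let $\mathcal{V}\subset\mathbb{R}[\mathcal{X}]$ be bounded, assume $\mathcal{F}_\omega$ is discriminable over $\mathcal{V}$, and assume the box-counting dimension $k=\operatorname{boxdim}(\overline{\mathcal{V}_{\mathcal{R}}})$ of the closure of $\mathcal{V}_{\mathcal{R}}$ exists. Consider linear maps $\Phi:\mathbb{R}^{\kappa_\omega}\to\mathbb{R}^m$ (with $m<\kappa_\omega$), identified with their $m\times\kappa_\omega$ matrices. If $m>2k$, then for almost every such $\Phi$ (with respect to Lebesgue measure on $\mathbb{R}^{m\times\kappa_\omega}$), the map $\mathbf{a}\mapsto \Phi\big(\mathcal{F}_\omega(\mathbf{a}^{\otimes\omega})\big)$ is discriminable over $\mathcal{V}$, i.e., it is one-to-one on $\mathcal{V}_{\mathcal{R}}$.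
   Context: $\mathbb{R}[\mathcal{X}]$ denotes the real vectors $\mathbf{a}=(a_x)_{x\in\mathcal{X}}$ (identified with $\mathbb{R}^n$). The group acts on the left on $\mathcal{X}$, $x\mapsto g(x)$, and on $\mathbb{R}[\mathcal{X}]$ by $\mathbf{a}\mapsto\mathbf{a}^g$ where $(\mathbf{a}^g)_{g(x)}=a_x$. For $\omega\ge1$, $\mathbb{R}[\mathcal{X}^{\times\omega}]$ is the space of real arrays $[\![b_{\mathbf{x}}]\!]$ indexed by $\omega$-tuples $\mathbf{x}=(x^{(1)},\dots,x^{(\omega)})\in\mathcal{X}^{\times\omega}$ (identified with $\mathbb{R}^{n^\omega}$, with the standard inner product), and $\mathbf{a}^{\otimes\omega}$ is the array with entries $a_{x^{(1)}}\cdots a_{x^{(\omega)}}$. $\mathcal{G}$ acts on $\mathcal{X}^{\times\omega}$ coordinatewise; let $\Omega_{\mathcal{G},1},\dots,\Omega_{\mathcal{G},\kappa_\omega}$ be the distinct $\mathcal{G}$-orbits on $\mathcal{X}^{\times\omega}$. Define $\mathcal{F}_\omega([\![a_{\mathbf{x}}]\!])=(z_1,\dots,z_{\kappa_\omega})$ with $z_i=(\#\Omega_{\mathcal{G},i})^{-1/2}\sum_{\mathbf{x}\in\Omega_{\mathcal{G},i}}a_{\mathbf{x}}$. An element $\mathbf{a}\in\mathbb{R}[\mathcal{X}]$ is un-fixable if $\mathbf{a}^g\neq\mathbf{a}$ for all $g\in\mathcal{G}$, $g\ne e$. A fundamental region is an open set $\mathcal{R}\subset\mathbb{R}[\mathcal{X}]$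 such that (i) all elements of $\mathcal{R}$ are un-fixable, (ii) the sets $\{\mathbf{a}^g:\mathbf{a}\in\mathcal{R}\}$, $g\in\mathcal{G}$, are pairwise disjoint, and (iii) their union contains all un-fixable elements of $\mathbb{R}[\mathcal{X}]$. For $\mathcal{V}\subset\mathbb{R}[\mathcal{X}]$, $\mathcal{V}_{\mathcal{R}}=\{\mathbf{a}^g\in\mathcal{R}:\mathbf{a}\in\mathcal{V},g\in\mathcal{G}\}$. A $\mathcal{G}$-invariant map $\Psi$ (applied to data as $\mathbf{a}\mapsto\Psi(\mathbf{a}^{\otimes\omega})$) is discriminable over $\mathcal{V}$ if $\mathbf{a}\mapsto\Psi(\mathbf{a}^{\otimes\omega})$ is one-to-one on $\mathcal{V}_{\mathcal{R}}$. The box-counting dimension of a bounded set $\mathcal{W}$ is $\lim_{\epsilon\to0}\log N_\epsilon(\mathcal{W})/(-\log\epsilon)$, where $N_\epsilon(\mathcal{W})$ is the minimal number of grid boxes of side $\epsilon$ needed to cover $\mathcal{W}$. *)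

theory Defs
  imports "HOL-Analysis.Analysis" "HOL-Algebra.Group_Action"
begin

text \<open>
  The group acts by a \<open>group_action\<close> \<open>G\<close>, \<open>UNIV\<close>, \<open>\<phi>\<close> on a finite type \<open>'x\<close>.
  Vectors indexed by the points are \<open>real ^ 'x\<close>, tuples of points are \<open>'x ^ 'w\<close>, and arrays
  indexed by tuples are \<open>real ^ ('x ^ 'w)\<close>.
\<close>

text \<open>The lemma \<open>vec_act_nth\<close> below is the characteristic property of this action.\<close>

definition vec_act :: "('g \<Rightarrow> 'x \<Rightarrow> 'x) \<Rightarrow> 'g \<Rightarrow> real ^ 'x \<Rightarrow> real ^ ('x::finite)" where
  "vec_act \<phi> g a = (\<chi> y. a $ (inv_into UNIV (\<phi> g) y))"

lemma vec_act_nth: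
  fixes \<phi> :: "'g \<Rightarrow> 'x::finite \<Rightarrow> 'x"
  assumes "group_action G UNIV \<phi>" "g \<in> carrier G"
  shows "vec_act \<phi> g a $ (\<phi> g x) = a $ x"
  using group_action.inj_prop[OF assms] by (simp add: vec_act_def)

definition tuple_act :: "('g \<Rightarrow> 'x \<Rightarrow> 'x) \<Rightarrow> 'g \<Rightarrow> 'x ^ 'w \<Rightarrow> 'x ^ ('w::finite)" where
  "tuple_act \<phi> g x = (\<chi> i. \<phi> g (x $ i))"

definition tensor_pow :: "real ^ 'x \<Rightarrow> real ^ (('x::finite) ^ ('w::finite))" where
  "tensor_pow a = (\<chi> x. \<Prod>i\<in>UNIV. a $ (x $ i))"

text \<open>
  \<open>\<Omega>\<close> is an enumeration, by a finite type \<open>'k\<close>, of the orbits on tuples; \<open>CARD('k)\<close> is thus the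
  number of orbits.
\<close>

definition orbit_map ::
  "('k \<Rightarrow> ('x ^ 'w) set) \<Rightarrow> real ^ (('x::finite) ^ ('w::finite)) \<Rightarrow> real ^ ('k::finite)" where
  "orbit_map \<Omega> b = (\<chi> i. real (card (\<Omega> i)) powr (- 1 / 2) * (\<Sum>x\<in>\<Omega> i. b $ x))"

definition unfixable :: "('g, 'e) monoid_scheme \<Rightarrow> ('g \<Rightarrow> 'x \<Rightarrow> 'x) \<Rightarrow> real ^ ('x::finite) \<Rightarrow> bool" where
  "unfixable G \<phi> a \<longleftrightarrow> (\<forall>g\<in>carrier G. g \<noteq> \<one>\<^bsub>G\<^esub> \<longrightarrow> vec_act \<phi> g a \<noteq> a)"

definition fundamental_region ::
  "('g, 'e) monoid_scheme \<Rightarrow> ('g \<Rightarrow> 'x \<Rightarrow> 'x) \<Rightarrow> (real ^ ('x::finite)) set \<Rightarrow> bool" where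
  "fundamental_region G \<phi> R \<longleftrightarrow>
     open R \<and>
     (\<forall>a\<in>R. unfixable G \<phi> a) \<and>
     disjoint_family_on (\<lambda>g. vec_act \<phi> g ` R) (carrier G) \<and>
     {a. unfixable G \<phi> a} \<subseteq> (\<Union>g\<in>carrier G. vec_act \<phi> g ` R)"

definition region_reps ::
  "('g, 'e) monoid_scheme \<Rightarrow> ('g \<Rightarrow> 'x \<Rightarrow> 'x) \<Rightarrow> (real ^ 'x) set \<Rightarrow> (real ^ 'x) set \<Rightarrow>
   (real ^ ('x::finite)) set" where
  "region_reps G \<phi> R V = {vec_act \<phi> g a | a g. a \<in> V \<and> g \<in> carrier G \<and> vec_act \<phi> g a \<in> R}"

definition discriminable ::
  "('g, 'e) monoid_scheme \<Rightarrow> ('g \<Rightarrow> 'x \<Rightarrow> 'x) \<Rightarrow> (real ^ 'x) set \<Rightarrow> (real ^ 'x) set \<Rightarrow>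
   (real ^ (('x::finite) ^ ('w::finite)) \<Rightarrow> 'b) \<Rightarrow> bool" where
  "discriminable G \<phi> R V \<Psi> \<longleftrightarrow> inj_on (\<lambda>a. \<Psi> (tensor_pow a)) (region_reps G \<phi> R V)"

definition grid_box :: "real \<Rightarrow> int ^ 'n \<Rightarrow> (real ^ ('n::finite)) set" where
  "grid_box \<epsilon> j = {x. \<forall>i. \<epsilon> * of_int (j $ i) \<le> x $ i \<and> x $ i \<le> \<epsilon> * (of_int (j $ i) + 1)}"

text \<open>Meaningful for bounded \<open>W\<close> and \<open>\<epsilon> > 0\<close>, where a finite cover exists.\<close>

definition box_number :: "real \<Rightarrow> (real ^ ('n::finite)) set \<Rightarrow> nat" where
  "box_number \<epsilon> W = (LEAST N. \<exists>J. finite J \<and> card J = N \<and> W \<subseteq> (\<Union>j\<in>J. grid_box \<epsilon> j))"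

text \<open>
  The limit exists and equals \<open>k\<close>. Since \<open>ln 0 = 0\<close>, the empty set gets dimension \<open>0\<close>.
\<close>

definition has_boxdim :: "(real ^ ('n::finite)) set \<Rightarrow> real \<Rightarrow> bool" where
  "has_boxdim W k \<longleftrightarrow> ((\<lambda>\<epsilon>. ln (real (box_number \<epsilon> W)) / (- ln \<epsilon>)) \<longlongrightarrow> k) (at_right 0)"

end

theory Submission
  imports Defs
begin

text \<open>
  On the bounded closure \<open>W\<close> of the set of representatives, the map \<open>f\<close> taking \<open>a\<close> to
  \<open>orbit_map \<Omega> (tensor_pow a)\<close> is Lipschitz. Fix \<open>\<delta> > 0\<close>, a coordinate \<open>j\<close> and a bound \<open>M\<close>, and
  consider the matrices with entries at most \<open>M\<close> that identify \<open>f a\<close> with \<open>f b\<close> for some \<open>a, b \<in> W\<close>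
  whose images differ by at least \<open>\<delta>\<close> in coordinate \<open>j\<close>. Cover \<open>W\<close> by \<open>N\<close> grid boxes of side \<open>\<epsilon>\<close>
  and choose one such pair for each pair of boxes containing one: every row of such a matrix is then
  orthogonal up to \<open>O(\<epsilon>)\<close> to one of \<open>N\<^sup>2\<close> fixed vectors, so these matrices lie in a set of measure
  \<open>O(N\<^sup>2 \<epsilon>\<^sup>m)\<close>. As \<open>N \<le> \<epsilon> powr (- s)\<close> for any \<open>s > k\<close> and small \<open>\<epsilon>\<close>, this tends to \<open>0\<close> for
  \<open>2 * s < m\<close>. Countably many choices of \<open>\<delta>, j, M\<close> exhaust all matrices that identify distinct image
  points.
\<close>

section \<open>Lebesgue measure on vectors as a product measure\<close>

lemma measurable_vec_lambda_PiM:
  "vec_lambda \<in> borel_measurable (\<Pi>\<^sub>M i\<in>(UNIV::'m::finite set). (lborel :: 'a::euclidean_space measure))"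
proof (subst borel_measurable_euclidean_space, rule ballI)
  fix b :: "'a ^ 'm" assume "b \<in> Basis"
  then obtain i u where b: "b = axis i u" by (auto simp: Basis_vec_def)
  show "(\<lambda>x. vec_lambda x \<bullet> b) \<in> borel_measurable (\<Pi>\<^sub>M i\<in>(UNIV::'m set). (lborel :: 'a measure))"
    unfolding b inner_axis by simp
qed

lemma prod_Basis_vec:
  "(\<Prod>b\<in>Basis. f b) = (\<Prod>i\<in>UNIV. \<Prod>b\<in>Basis. f (axis i b :: 'a::euclidean_space ^ 'm::finite))"
proof -
  have "(\<Prod>b\<in>Basis. f b) = (\<Prod>i\<in>UNIV. \<Prod>b\<in>axis i ` Basis. f (b :: 'a ^ 'm))"
    unfolding Basis_vec_def UNION_singleton_eq_range
    by (rule prod.UNION_disjoint) (auto simp: axis_eq_axis)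
  also have "\<dots> = (\<Prod>i\<in>UNIV. \<Prod>b\<in>Basis. f (axis i b :: 'a ^ 'm))"
    by (intro prod.cong refl, subst prod.reindex) (auto simp: inj_on_def axis_eq_axis)
  finally show ?thesis .
qed

text \<open>Agreement on open boxes suffices by \<open>lborel_eqI\<close>: a box of vectors is the
  product of the boxes of its entries, and its volume factors over the coordinates. The entries
  range over any Euclidean space, so that the result covers both a matrix as a vector of rows and a
  row as a vector of reals.\<close>

lemma lborel_vec_eq_distr_PiM:
  "(lborel :: ('a::euclidean_space ^ 'm::finite) measure) = distr (\<Pi>\<^sub>M i\<in>UNIV. lborel) borel vec_lambda"
proof (rule lborel_eqI)
  interpret product_sigma_finite "\<lambda>_::'m. lborel :: 'a measure" ..
  fix l u :: "'a ^ 'm" assume le: "\<And>b. b \<in> Basis \<Longrightarrow> l \<bullet> b \<le> u \<bullet> b"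
  have le': "l $ i \<bullet> b \<le> u $ i \<bullet> b" if "b \<in> Basis" for i b
    using le[of "axis i b"] that by (simp add: inner_axis)
  have "vec_lambda -` box l u \<inter> space (\<Pi>\<^sub>M i\<in>(UNIV::'m set). (lborel :: 'a measure))
      = (\<Pi>\<^sub>E i\<in>UNIV. box (l $ i) (u $ i))"
    by (auto simp: space_PiM box_def Basis_vec_def inner_axis PiE_iff)
  then have "emeasure (distr (\<Pi>\<^sub>M i\<in>(UNIV::'m set). (lborel :: 'a measure)) borel vec_lambda) (box l u)
      = (\<Prod>i\<in>UNIV. emeasure lborel (box (l $ i) (u $ i)))"
    by (simp add: emeasure_distr measurable_vec_lambda_PiM emeasure_PiM)
  also have "\<dots> = (\<Prod>i\<in>UNIV. ennreal (\<Prod>b\<in>Basis. (u $ i - l $ i) \<bullet> b))"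
    using le' by (simp add: emeasure_lborel_box_eq)
  also have "\<dots> = ennreal (\<Prod>i\<in>UNIV. \<Prod>b\<in>Basis. (u $ i - l $ i) \<bullet> b)"
    using le' by (intro prod_ennreal prod_nonneg) (simp add: inner_diff_left)
  also have "(\<Prod>i\<in>UNIV. \<Prod>b\<in>Basis. (u $ i - l $ i) \<bullet> b) = (\<Prod>b\<in>Basis. (u - l) \<bullet> b)"
    by (simp add: prod_Basis_vec inner_axis)
  finally show "emeasure (distr (\<Pi>\<^sub>M i\<in>(UNIV::'m set). (lborel :: 'a measure)) borel vec_lambda) (box l u)
      = ennreal (\<Prod>b\<in>Basis. (u - l) \<bullet> b)" .
qed simp

text \<open>Imposing the same condition on each row independently raises its measure to the power
  \<open>CARD('m)\<close>; this is the source of the factor \<epsilon> to the power m that has to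
  beat the number of box pairs.\<close>

lemma emeasure_lborel_vec_power:
  fixes S :: "'a::euclidean_space set"
  assumes S: "S \<in> sets borel"
  shows "emeasure lborel {\<Phi> :: 'a ^ 'm::finite. \<forall>i. \<Phi> $ i \<in> S} = emeasure lborel S ^ CARD('m)"
proof -
  interpret product_sigma_finite "\<lambda>_::'m. lborel :: 'a measure" ..
  have nth: "(\<lambda>\<Phi> :: 'a ^ 'm. \<Phi> $ i) \<in> borel_measurable borel" for i
    by (intro borel_measurable_continuous_onI continuous_intros)
  have "{\<Phi> :: 'a ^ 'm. \<forall>i. \<Phi> $ i \<in> S} = (\<Inter>i. (\<lambda>\<Phi>. \<Phi> $ i) -` S \<inter> space borel)"
    by auto
  also have "\<dots> \<in> sets borel"
    using measurable_sets[OF nth S] by (intro sets.finite_INT) auto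
  finally have sets: "{\<Phi> :: 'a ^ 'm. \<forall>i. \<Phi> $ i \<in> S} \<in> sets borel" .
  have "vec_lambda -` {\<Phi> :: 'a ^ 'm. \<forall>i. \<Phi> $ i \<in> S} \<inter> space (\<Pi>\<^sub>M i\<in>(UNIV::'m set). (lborel :: 'a measure))
      = (\<Pi>\<^sub>E i\<in>UNIV. S)"
    by (auto simp: space_PiM PiE_iff)
  then show ?thesis
    using sets S
    by (subst lborel_vec_eq_distr_PiM) (simp add: emeasure_distr measurable_vec_lambda_PiM emeasure_PiM)
qed

section \<open>Measure of slabs, for rows and for matrices\<close>

lemma closed_slab: "closed {r :: real ^ 'k. (\<forall>l. \<bar>r $ l\<bar> \<le> M) \<and> \<bar>r \<bullet> u\<bar> \<le> c}"
  by (intro closed_Collect_all closed_Collect_conj closed_Collect_le continuous_intros)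

text \<open>By Fubini: once the coordinates other than \<open>j\<close> are fixed in the cube, the
  slab confines the \<open>j\<close>-th one to an interval of length
  \<open>2 * c / \<bar>u $ j\<bar>\<close>; the others contribute at most the volume of a cube of
  one dimension less.\<close>

lemma emeasure_slab_le:
  fixes u :: "real ^ 'k::finite"
  assumes "0 \<le> M" "0 \<le> c" "u $ j \<noteq> 0"
  shows "emeasure lborel {r. (\<forall>l. \<bar>r $ l\<bar> \<le> M) \<and> \<bar>r \<bullet> u\<bar> \<le> c}
         \<le> ennreal (2 * c * (2 * M) ^ (CARD('k) - 1) / \<bar>u $ j\<bar>)" (is "emeasure lborel ?S \<le> _")
proof -
  interpret product_sigma_finite "\<lambda>_::'k. lborel :: real measure" ..
  let ?I = "UNIV - {j}"
  let ?P = "\<Pi>\<^sub>M l\<in>?I. (lborel :: real measure)"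
  let ?Q = "\<Pi>\<^sub>E l\<in>?I. {- M..M}"
  have S: "?S \<in> sets borel" using closed_slab by simp
  have "emeasure lborel ?S = (\<integral>\<^sup>+x. indicator ?S x \<partial>(lborel :: (real ^ 'k) measure))"
    using S by simp
  \<comment> \<open>The index set is written as \<open>insert j ?I\<close> to make coordinate
    \<open>j\<close> the inner integration variable.\<close>
  also have "\<dots> = (\<integral>\<^sup>+x. indicator ?S (vec_lambda x) \<partial>(\<Pi>\<^sub>M l\<in>insert j ?I. (lborel :: real measure)))"
    unfolding lborel_vec_eq_distr_PiM using S
    by (subst nn_integral_distr) (auto simp: measurable_vec_lambda_PiM insert_absorb)
  also have "\<dots> = (\<integral>\<^sup>+x. \<integral>\<^sup>+y. indicator ?S (vec_lambda (x(j := y))) \<partial>lborel \<partial>?P)"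
  proof (rule product_nn_integral_insert)
    have "vec_lambda \<in> borel_measurable (\<Pi>\<^sub>M l\<in>insert j ?I. (lborel :: real measure))"
      using measurable_vec_lambda_PiM by (simp add: insert_absorb)
    then show "(\<lambda>x. indicator ?S (vec_lambda x) :: ennreal)
        \<in> borel_measurable (\<Pi>\<^sub>M l\<in>insert j ?I. (lborel :: real measure))"
      using S by (intro measurable_compose[OF _ borel_measurable_indicator]) auto
  qed auto
  also have "\<dots> \<le> (\<integral>\<^sup>+x. ennreal (2 * c / \<bar>u $ j\<bar>) * indicator ?Q x \<partial>?P)"
  proof (rule nn_integral_mono)
    fix x :: "'k \<Rightarrow> real" assume x: "x \<in> space ?P"
    show "(\<integral>\<^sup>+y. indicator ?S (vec_lambda (x(j := y))) \<partial>lborel)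
        \<le> ennreal (2 * c / \<bar>u $ j\<bar>) * indicator ?Q x"
    proof (cases "x \<in> ?Q")
      case True
      define s where "s = (\<Sum>l\<in>?I. x l * u $ l)"
      have inner: "(\<chi> l. (x(j := y)) l) \<bullet> u = y * u $ j + s" for y
        unfolding inner_vec_def s_def by (subst sum.remove[of _ j]) auto
      \<comment> \<open>Solve the slab inequality for \<open>y\<close>; the bound on
        \<open>y\<close> itself by \<open>M\<close> is dropped in this estimate.\<close>
      have "y \<in> {- s / u $ j - c / \<bar>u $ j\<bar> .. - s / u $ j + c / \<bar>u $ j\<bar>}"
        if "\<bar>y * u $ j + s\<bar> \<le> c" for y
      proof -
        have "\<bar>y + s / u $ j\<bar> = \<bar>y * u $ j + s\<bar> / \<bar>u $ j\<bar>"
          using assms(3) by (simp add: abs_divide[symmetric] add_divide_distrib)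
        also have "\<dots> \<le> c / \<bar>u $ j\<bar>"
          using that by (intro divide_right_mono) auto
        finally show ?thesis by (auto simp: abs_le_iff)
      qed
      then have "(\<integral>\<^sup>+y. indicator ?S (vec_lambda (x(j := y))) \<partial>lborel)
          \<le> (\<integral>\<^sup>+y. indicator {- s / u $ j - c / \<bar>u $ j\<bar> .. - s / u $ j + c / \<bar>u $ j\<bar>} y \<partial>lborel)"
        by (intro nn_integral_mono) (auto simp: indicator_def inner simp del: atLeastAtMost_iff)
      also have "\<dots> = ennreal (2 * c / \<bar>u $ j\<bar>)"
        using assms by simp
      finally show ?thesis using True by simp
    next
      case False
      then obtain l where "l \<noteq> j" "x l \<notin> {- M..M}"
        using x by (auto simp: space_PiM PiE_iff simp del: atLeastAtMost_iff)
      then have "l \<noteq> j" "\<not> \<bar>x l\<bar> \<le> M" by auto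
      then have "vec_lambda (x(j := y)) \<notin> ?S" for y by auto
      then show ?thesis by simp
    qed
  qed
  also have "\<dots> = ennreal (2 * c / \<bar>u $ j\<bar>) * emeasure ?P ?Q"
    by (intro nn_integral_cmult_indicator sets_PiM_I_finite) auto
  also have "emeasure ?P ?Q = ennreal ((2 * M) ^ (CARD('k) - 1))"
    using \<open>0 \<le> M\<close> by (subst emeasure_PiM) (auto simp: card_Diff_singleton ennreal_power)
  finally show ?thesis
    using assms by (simp add: ennreal_mult[symmetric])
qed

text \<open>Replacing \<open>\<bar>u $ j\<bar>\<close> by its lower bound \<open>\<delta>\<close>
  makes the estimate uniform in \<open>u\<close>, so that it can be summed over all chosen
  pairs.\<close>

lemma measure_matrix_slab_le:
  fixes u :: "real ^ 'k::finite"
  assumes "0 \<le> M" "0 \<le> c" "0 < \<delta>" "\<delta> \<le> \<bar>u $ j\<bar>"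
  defines "T \<equiv> {\<Phi> :: real ^ 'k ^ 'm::finite. \<forall>i. (\<forall>l. \<bar>\<Phi> $ i $ l\<bar> \<le> M) \<and> \<bar>\<Phi> $ i \<bullet> u\<bar> \<le> c}"
  shows "T \<in> lmeasurable"
    and "measure lebesgue T \<le> (2 * c * (2 * M) ^ (CARD('k) - 1) / \<delta>) ^ CARD('m)"
proof -
  let ?S = "{r :: real ^ 'k. (\<forall>l. \<bar>r $ l\<bar> \<le> M) \<and> \<bar>r \<bullet> u\<bar> \<le> c}"
  let ?b = "2 * c * (2 * M) ^ (CARD('k) - 1) / \<delta>"
  have "emeasure lborel ?S \<le> ennreal (2 * c * (2 * M) ^ (CARD('k) - 1) / \<bar>u $ j\<bar>)"
    using assms by (intro emeasure_slab_le) auto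
  also have "\<dots> \<le> ennreal ?b"
    using assms by (intro ennreal_leI divide_left_mono) auto
  finally have S: "emeasure lborel ?S \<le> ennreal ?b" .
  have T: "T = {\<Phi>. \<forall>i. \<Phi> $ i \<in> ?S}" by (simp add: T_def)
  have "emeasure lborel T = emeasure lborel ?S ^ CARD('m)"
    unfolding T by (rule emeasure_lborel_vec_power) (simp add: closed_slab)
  also have "\<dots> \<le> ennreal ?b ^ CARD('m)"
    using S by (rule power_mono) simp
  also have "\<dots> = ennreal (?b ^ CARD('m))"
    using assms by (simp add: ennreal_power)
  finally have eT: "emeasure lborel T \<le> ennreal (?b ^ CARD('m))" .
  have "closed T"
    unfolding T_def by (intro closed_Collect_all closed_Collect_conj closed_Collect_le continuous_intros)
  then have b: "T \<in> sets borel" by simp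
  have "emeasure lebesgue T \<le> ennreal (?b ^ CARD('m))"
    using eT b by (simp add: emeasure_completion)
  then show "T \<in> lmeasurable"
    using b by (intro fmeasurableI) (auto simp: order_le_less_trans)
  show "measure lebesgue T \<le> ?b ^ CARD('m)"
    using eT b assms by (simp add: measure_def enn2real_leI)
qed

section \<open>Grid covers and the box-counting dimension\<close>

lemma finite_box_cover:
  fixes W :: "(real ^ 'n::finite) set"
  assumes "bounded W" "0 < \<epsilon>"
  shows "\<exists>J. finite J \<and> W \<subseteq> (\<Union>j\<in>J. grid_box \<epsilon> j)"
proof -
  obtain M where M: "\<And>x. x \<in> W \<Longrightarrow> norm x \<le> M"
    using \<open>bounded W\<close> by (auto simp: bounded_iff)
  define J where "J = vec_lambda ` (\<Pi>\<^sub>E i\<in>(UNIV :: 'n set). {\<lfloor>- (M / \<epsilon>)\<rfloor>..\<lfloor>M / \<epsilon>\<rfloor>})"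
  have "finite J"
    unfolding J_def by (intro finite_imageI finite_PiE) auto
  moreover have "W \<subseteq> (\<Union>j\<in>J. grid_box \<epsilon> j)"
  proof
    fix x assume x: "x \<in> W"
    define j where "j = (\<chi> i. \<lfloor>x $ i / \<epsilon>\<rfloor>)"
    have "- (M / \<epsilon>) \<le> x $ i / \<epsilon> \<and> x $ i / \<epsilon> \<le> M / \<epsilon>" for i
      using order_trans[OF component_le_norm_cart M[OF x], of i] \<open>0 < \<epsilon>\<close>
      by (simp add: field_simps abs_le_iff)
    then have "j $ i \<in> {\<lfloor>- (M / \<epsilon>)\<rfloor>..\<lfloor>M / \<epsilon>\<rfloor>}" for i
      unfolding j_def by (auto intro!: floor_mono)
    then have "j \<in> J"
      unfolding J_def by (intro image_eqI[of _ _ "($) j"]) auto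
    moreover have "x \<in> grid_box \<epsilon> j"
    proof -
      have "\<epsilon> * of_int (j $ i) \<le> x $ i \<and> x $ i \<le> \<epsilon> * (of_int (j $ i) + 1)" for i
        using floor_divide_lower[OF \<open>0 < \<epsilon>\<close>, of "x $ i"] floor_divide_upper[OF \<open>0 < \<epsilon>\<close>, of "x $ i"]
        by (simp add: j_def mult.commute)
      then show ?thesis by (simp add: grid_box_def)
    qed
    ultimately show "x \<in> (\<Union>j\<in>J. grid_box \<epsilon> j)" by blast
  qed
  ultimately show ?thesis by blast
qed

text \<open>The \<open>LEAST\<close> in \<open>box_number\<close> is attained because boundedness
  provides at least one finite cover.\<close>

lemma box_number_cover:
  fixes W :: "(real ^ 'n::finite) set"
  assumes "bounded W" "0 < \<epsilon>"
  obtains J where "finite J" "card J = box_number \<epsilon> W" "W \<subseteq> (\<Union>j\<in>J. grid_box \<epsilon> j)"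
proof -
  have "\<exists>N J. finite J \<and> card J = N \<and> W \<subseteq> (\<Union>j\<in>J. grid_box \<epsilon> j)"
    using finite_box_cover[OF assms] by blast
  from LeastI_ex[OF this] that show thesis
    unfolding box_number_def by blast
qed

lemma dist_grid_box_le:
  fixes x y :: "real ^ 'n::finite"
  assumes "x \<in> grid_box \<epsilon> j" "y \<in> grid_box \<epsilon> j"
  shows "dist x y \<le> real CARD('n) * \<epsilon>"
proof -
  have "\<bar>(x - y) $ i\<bar> \<le> \<epsilon>" for i
  proof -
    have "\<epsilon> * of_int (j $ i) \<le> x $ i" "x $ i \<le> \<epsilon> * of_int (j $ i) + \<epsilon>"
      "\<epsilon> * of_int (j $ i) \<le> y $ i" "y $ i \<le> \<epsilon> * of_int (j $ i) + \<epsilon>"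
      using assms by (auto simp: grid_box_def algebra_simps)
    then show ?thesis by simp
  qed
  then have "(\<Sum>i\<in>UNIV. \<bar>(x - y) $ i\<bar>) \<le> real CARD('n) * \<epsilon>"
    by (rule sum_bounded_above)
  then show ?thesis
    using norm_le_l1_cart[of "x - y"] by (simp add: dist_norm)
qed

text \<open>Only the upper half of the limit is used. The slack between \<open>k\<close> and
  \<open>s\<close> turns it into an eventual strict inequality, which is multiplied by
  \<open>- ln \<epsilon>\<close>, positive for \<epsilon> < 1, and exponentiated.\<close>

lemma has_boxdim_eventually_le:
  assumes "has_boxdim W k" "k < s"
  shows "\<forall>\<^sub>F \<epsilon> in at_right 0. real (box_number \<epsilon> W) \<le> \<epsilon> powr (- s)"
proof -
  have "\<forall>\<^sub>F \<epsilon> in at_right 0. ln (real (box_number \<epsilon> W)) / (- ln \<epsilon>) < s"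
    using assms unfolding has_boxdim_def by (rule order_tendstoD)
  moreover have "\<forall>\<^sub>F \<epsilon> in at_right (0::real). \<epsilon> < 1"
    by (rule order_tendstoD(2)[OF tendsto_ident_at]) simp
  moreover have "\<forall>\<^sub>F \<epsilon> in at_right (0::real). 0 < \<epsilon>"
    by (rule eventually_at_right_less)
  ultimately show ?thesis
  proof eventually_elim
    case (elim \<epsilon>)
    show ?case
    \<comment> \<open>Since \<open>ln 0 = 0\<close>, \<open>exp (ln N)\<close> returns
      \<open>N\<close> only for positive \<open>N\<close>; an empty \<open>W\<close> is handled
      apart.\<close>
    proof (cases "box_number \<epsilon> W = 0")
      case False
      have "ln (real (box_number \<epsilon> W)) < - s * ln \<epsilon>"
        using elim by (simp add: field_simps)
      then have "exp (ln (real (box_number \<epsilon> W))) \<le> exp (- s * ln \<epsilon>)"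
        by simp
      then show ?thesis using False elim by (simp add: powr_def)
    qed simp
  qed
qed

section \<open>Lipschitz and boundedness properties of the maps involved\<close>

lemma lipschitz_on_tensor_pow:
  fixes W :: "(real ^ 'x::finite) set"
  assumes "bounded W"
  obtains L where "L-lipschitz_on W (tensor_pow :: _ \<Rightarrow> real ^ ('x ^ 'w::finite))"
proof -
  obtain M where M: "0 < M" "\<And>x. x \<in> W \<Longrightarrow> norm x \<le> M"
    using \<open>bounded W\<close> by (auto simp: bounded_pos)
  \<comment> \<open>\<open>M ^ CARD('w)\<close> undoes the rescaling of all factors by
    \<open>M\<close>; the rescaled product changes by at most the sum of \<open>CARD('w)\<close>
    differences, each at most \<open>dist a b / M\<close>.\<close>
  define K where "K = M ^ CARD('w) * (real CARD('w) / M)"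
  have entry: "\<bar>(tensor_pow a - tensor_pow b) $ x\<bar> \<le> K * dist a b"
    if "a \<in> W" "b \<in> W" for a b and x :: "'x ^ 'w"
  proof -
    \<comment> \<open>\<open>norm_prod_diff\<close> needs factors of norm at most 1, hence the division by \<open>M\<close>.\<close>
    have le1: "norm (a $ i / M) \<le> 1" if "a \<in> W" for a i
      using order_trans[OF component_le_norm_cart M(2)[OF that], of i] \<open>0 < M\<close> by simp
    have scale: "tensor_pow a $ x = M ^ CARD('w) * (\<Prod>i\<in>UNIV. a $ (x $ i) / M)" for a
      using \<open>0 < M\<close> by (simp add: tensor_pow_def prod_dividef)
    have "\<bar>(\<Prod>i\<in>UNIV. a $ (x $ i) / M) - (\<Prod>i\<in>UNIV. b $ (x $ i) / M)\<bar>
        \<le> (\<Sum>i\<in>UNIV. norm (a $ (x $ i) / M - b $ (x $ i) / M))"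
      using norm_prod_diff[of UNIV "\<lambda>i. a $ (x $ i) / M" "\<lambda>i. b $ (x $ i) / M"] le1 that by simp
    also have "\<dots> \<le> real CARD('w) * (dist a b / M)"
    proof (rule sum_bounded_above)
      fix i
      have "norm (a $ (x $ i) / M - b $ (x $ i) / M) = \<bar>(a - b) $ (x $ i)\<bar> / M"
        using \<open>0 < M\<close> by (simp add: diff_divide_distrib[symmetric])
      also have "\<dots> \<le> dist a b / M"
        using component_le_norm_cart[of "a - b" "x $ i"] \<open>0 < M\<close>
        by (intro divide_right_mono) (auto simp: dist_norm)
      finally show "norm (a $ (x $ i) / M - b $ (x $ i) / M) \<le> dist a b / M" .
    qed
    finally have "M ^ CARD('w) * \<bar>(\<Prod>i\<in>UNIV. a $ (x $ i) / M) - (\<Prod>i\<in>UNIV. b $ (x $ i) / M)\<bar>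
        \<le> M ^ CARD('w) * (real CARD('w) * (dist a b / M))"
      using \<open>0 < M\<close> by (intro mult_left_mono) auto
    then show ?thesis
      using \<open>0 < M\<close> unfolding K_def vector_minus_component scale
      by (simp add: right_diff_distrib[symmetric] abs_mult)
  qed
  have "(real CARD('x ^ 'w) * K)-lipschitz_on W (tensor_pow :: _ \<Rightarrow> real ^ ('x ^ 'w))"
  proof (rule lipschitz_onI)
    fix a b assume "a \<in> W" "b \<in> W"
    then have "(\<Sum>x\<in>UNIV. \<bar>(tensor_pow a - tensor_pow b) $ (x :: 'x ^ 'w)\<bar>) \<le> real CARD('x ^ 'w) * (K * dist a b)"
      by (intro sum_bounded_above entry)
    then show "dist (tensor_pow a) (tensor_pow b :: real ^ ('x ^ 'w)) \<le> real CARD('x ^ 'w) * K * dist a b"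
      using norm_le_l1_cart[of "tensor_pow a - tensor_pow b :: real ^ ('x ^ 'w)"]
      by (simp add: dist_norm mult.assoc)
  qed (use \<open>0 < M\<close> in \<open>simp add: K_def\<close>)
  then show thesis by (rule that)
qed

lemma bounded_linear_orbit_map: "bounded_linear (orbit_map \<Omega>)"
proof -
  have "linear (orbit_map \<Omega>)"
    by (rule linearI)
       (simp_all add: orbit_map_def vec_eq_iff sum.distrib distrib_left sum_distrib_left mult.left_commute)
  then show ?thesis by (simp add: linear_conv_bounded_linear)
qed

text \<open>Each group element acts linearly, so this is a finite union of bounded linear images of
  \<open>V\<close>.\<close>

lemma bounded_vec_act_images:
  assumes "bounded V" "finite H"
  shows "bounded {vec_act \<phi> g a | a g. a \<in> V \<and> g \<in> H}"
proof -
  have lin: "bounded_linear (vec_act \<phi> g)" for g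
    unfolding linear_conv_bounded_linear[symmetric]
    by (rule linearI) (simp_all add: vec_act_def vec_eq_iff)
  have "bounded (\<Union>g\<in>H. vec_act \<phi> g ` V)"
    using assms by (intro bounded_UN ballI bounded_linear_image[OF _ lin]) auto
  then show ?thesis
    by (rule bounded_subset) auto
qed

section \<open>Matrices that identify distinct image points form a null set\<close>

lemma negligible_collapsing_matrices:
  fixes f :: "real ^ 'x::finite \<Rightarrow> real ^ 'k::finite"
  assumes "bounded W" and lip: "L-lipschitz_on W f" and "0 \<le> M" "0 < \<delta>"
    and boxes: "\<forall>\<^sub>F \<epsilon> in at_right 0. real (box_number \<epsilon> W) \<le> \<epsilon> powr (- s)"
    and s: "2 * s < real CARD('m::finite)"
  shows "negligible {\<Phi> :: real ^ 'k ^ 'm. (\<forall>i l. \<bar>\<Phi> $ i $ l\<bar> \<le> M) \<and>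
           (\<exists>a\<in>W. \<exists>b\<in>W. \<delta> \<le> \<bar>(f a - f b) $ j\<bar> \<and> \<Phi> *v f a = \<Phi> *v f b)}"
    (is "negligible ?B")
  unfolding negligible_outer_le
proof (intro allI impI)
  fix e :: real assume "0 < e"
  \<comment> \<open>\<open>real CARD('k) * M\<close> bounds the norm of a row; the other factor,
    times \<epsilon>, bounds the total displacement of the two image points within their boxes.
    \<open>D * \<epsilon>\<close> is then the bound for one row in a slab of half-width
    \<open>C * \<epsilon>\<close>.\<close>
  define C where "C = real CARD('k) * M * (2 * L * real CARD('x))"
  define D where "D = 2 * C * (2 * M) ^ (CARD('k) - 1) / \<delta>"
  have "0 \<le> L" using lip by (rule lipschitz_on_nonneg)
  then have "0 \<le> C" "0 \<le> D" using assms(3,4) by (auto simp: C_def D_def)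
  \<comment> \<open>The exponent is what remains of \<epsilon> to the power m after the loss of a
    factor \<open>\<epsilon> powr (- s)\<close> for each of the two boxes; it is positive by
    \<open>s\<close>.\<close>
  have "((\<lambda>\<epsilon>. \<epsilon> powr (real CARD('m) - 2 * s)) \<longlongrightarrow> 0) (at_right 0)"
    using s by (intro tendsto_zero_powrI tendsto_ident_at tendsto_const)
      (auto simp: eventually_at_filter)
  then have "((\<lambda>\<epsilon>. D ^ CARD('m) * \<epsilon> powr (real CARD('m) - 2 * s)) \<longlongrightarrow> D ^ CARD('m) * 0) (at_right 0)"
    by (rule tendsto_mult_left)
  then have "\<forall>\<^sub>F \<epsilon> in at_right 0. D ^ CARD('m) * \<epsilon> powr (real CARD('m) - 2 * s) < e"
    using \<open>0 < e\<close> by (intro order_tendstoD) auto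
  then have "\<forall>\<^sub>F \<epsilon> in at_right 0. 0 < \<epsilon> \<and> real (box_number \<epsilon> W) \<le> \<epsilon> powr (- s)
      \<and> D ^ CARD('m) * \<epsilon> powr (real CARD('m) - 2 * s) < e"
    using boxes eventually_at_right_less[of 0] by eventually_elim auto
  then obtain \<epsilon> where \<epsilon>: "0 < \<epsilon>" "real (box_number \<epsilon> W) \<le> \<epsilon> powr (- s)"
      "D ^ CARD('m) * \<epsilon> powr (real CARD('m) - 2 * s) < e"
    using eventually_happens[of _ "at_right (0::real)"] by auto
  obtain J where J: "finite J" "card J = box_number \<epsilon> W" "W \<subseteq> (\<Union>j\<in>J. grid_box \<epsilon> j)"
    using box_number_cover[OF \<open>bounded W\<close> \<open>0 < \<epsilon>\<close>] by blast
  \<comment> \<open>The representatives are points of \<open>W\<close> rather than box centres,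
    because the Lipschitz bound holds on \<open>W\<close>. They must themselves be separated by
    \<open>\<delta>\<close> in coordinate \<open>j\<close>, as the slab estimate divides by that
    coordinate.\<close>
  define P where "P p a b \<longleftrightarrow> a \<in> W \<inter> grid_box \<epsilon> (fst p) \<and> b \<in> W \<inter> grid_box \<epsilon> (snd p)
      \<and> \<delta> \<le> \<bar>(f a - f b) $ j\<bar>" for p a b
  define I where "I = {p \<in> J \<times> J. \<exists>a b. P p a b}"
  have "\<forall>p\<in>I. \<exists>a b. P p a b" by (auto simp: I_def)
  then obtain A B where AB: "\<And>p. p \<in> I \<Longrightarrow> P p (A p) (B p)" by metis
  define T where "T p = {\<Phi> :: real ^ 'k ^ 'm. \<forall>i. (\<forall>l. \<bar>\<Phi> $ i $ l\<bar> \<le> M)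
      \<and> \<bar>\<Phi> $ i \<bullet> (f (A p) - f (B p))\<bar> \<le> C * \<epsilon>}" for p
  have T: "T p \<in> lmeasurable \<and> measure lebesgue (T p) \<le> (D * \<epsilon>) ^ CARD('m)" if "p \<in> I" for p
  proof -
    have "\<delta> \<le> \<bar>(f (A p) - f (B p)) $ j\<bar>" using AB[OF that] by (simp add: P_def)
    moreover have "0 \<le> C * \<epsilon>" using \<open>0 \<le> C\<close> \<open>0 < \<epsilon>\<close> by simp
    moreover have "2 * (C * \<epsilon>) * (2 * M) ^ (CARD('k) - 1) / \<delta> = D * \<epsilon>"
      by (simp add: D_def)
    ultimately show ?thesis
      using measure_matrix_slab_le[OF \<open>0 \<le> M\<close> _ \<open>0 < \<delta>\<close>, of "C * \<epsilon>" "f (A p) - f (B p)" j, where 'm = 'm]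
      unfolding T_def by auto
  qed
  have finI: "finite I" and cardI: "card I \<le> (card J)\<^sup>2"
    using \<open>finite J\<close> card_mono[of "J \<times> J" I]
    by (auto simp: I_def power2_eq_square card_cartesian_product)
  have "?B \<subseteq> (\<Union>p\<in>I. T p)"
  proof clarify
    fix \<Phi> :: "real ^ 'k ^ 'm" and a b
    assume \<Phi>: "\<forall>i l. \<bar>\<Phi> $ i $ l\<bar> \<le> M" and ab: "a \<in> W" "b \<in> W" "\<delta> \<le> \<bar>(f a - f b) $ j\<bar>"
      and eq: "\<Phi> *v f a = \<Phi> *v f b"
    obtain j1 j2 where "j1 \<in> J" "a \<in> grid_box \<epsilon> j1" "j2 \<in> J" "b \<in> grid_box \<epsilon> j2"
      using J(3) ab(1,2) by blast
    then obtain p where p: "p \<in> J \<times> J" "a \<in> grid_box \<epsilon> (fst p)" "b \<in> grid_box \<epsilon> (snd p)"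
      using that[of "(j1, j2)"] by simp
    then have "p \<in> I" using ab by (auto simp: I_def P_def)
    let ?a = "A p" and ?b = "B p"
    have AB': "?a \<in> W" "?b \<in> W" "?a \<in> grid_box \<epsilon> (fst p)" "?b \<in> grid_box \<epsilon> (snd p)"
      using AB[OF \<open>p \<in> I\<close>] by (auto simp: P_def)
    have lip_box: "norm (f x - f y) \<le> L * (real CARD('x) * \<epsilon>)"
      if "x \<in> W" "y \<in> W" "x \<in> grid_box \<epsilon> q" "y \<in> grid_box \<epsilon> q" for x y q
    proof -
      have "norm (f x - f y) \<le> L * dist x y"
        using lipschitz_onD[OF lip that(1,2)] by (simp add: dist_norm)
      also have "\<dots> \<le> L * (real CARD('x) * \<epsilon>)"
        using dist_grid_box_le[OF that(3,4)] \<open>0 \<le> L\<close> by (rule mult_left_mono)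
      finally show ?thesis .
    qed
    have "\<bar>\<Phi> $ i \<bullet> (f ?a - f ?b)\<bar> \<le> C * \<epsilon>" for i
    proof -
      have "\<Phi> $ i \<bullet> f a = \<Phi> $ i \<bullet> f b"
        using arg_cong[OF eq, of "\<lambda>v. v $ i"] by (simp add: matrix_vector_mul_component)
      \<comment> \<open>Subtracting the vanishing product of the row with \<open>f a - f b\<close>
        leaves only displacements inside common boxes, which are of order \<epsilon>.\<close>
      then have "\<Phi> $ i \<bullet> (f ?a - f ?b) = \<Phi> $ i \<bullet> ((f ?a - f a) - (f ?b - f b))"
        by (simp add: inner_diff_right)
      also have "\<bar>\<dots>\<bar> \<le> norm (\<Phi> $ i) * norm ((f ?a - f a) - (f ?b - f b))"
        by (rule Cauchy_Schwarz_ineq2)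
      also have "\<dots> \<le> (real CARD('k) * M) * (L * (real CARD('x) * \<epsilon>) + L * (real CARD('x) * \<epsilon>))"
      proof (intro mult_mono)
        have "(\<Sum>l\<in>UNIV. \<bar>\<Phi> $ i $ l\<bar>) \<le> real CARD('k) * M"
          using \<Phi> by (intro sum_bounded_above) auto
        then show "norm (\<Phi> $ i) \<le> real CARD('k) * M"
          using norm_le_l1_cart[of "\<Phi> $ i"] by simp
        show "norm ((f ?a - f a) - (f ?b - f b)) \<le> L * (real CARD('x) * \<epsilon>) + L * (real CARD('x) * \<epsilon>)"
          using lip_box[OF AB'(1) ab(1) AB'(3) p(2)] lip_box[OF AB'(2) ab(2) AB'(4) p(3)]
            norm_triangle_ineq4[of "f ?a - f a" "f ?b - f b"] by linarith
      qed (use \<open>0 \<le> M\<close> in auto)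
      finally show ?thesis by (simp add: C_def algebra_simps)
    qed
    then show "\<Phi> \<in> (\<Union>p\<in>I. T p)"
      using \<open>p \<in> I\<close> \<Phi> by (auto simp: T_def)
  qed
  moreover have "(\<Union>p\<in>I. T p) \<in> lmeasurable"
    using finI T by (intro fmeasurable.finite_UN) auto
  moreover have "measure lebesgue (\<Union>p\<in>I. T p) \<le> e"
  proof -
    have "measure lebesgue (\<Union>p\<in>I. T p) \<le> (\<Sum>p\<in>I. measure lebesgue (T p))"
      using finI T by (intro measure_UNION_le) auto
    also have "\<dots> \<le> real (card I) * (D * \<epsilon>) ^ CARD('m)"
      using T by (intro sum_bounded_above) auto
    also have "\<dots> \<le> (\<epsilon> powr (- s))\<^sup>2 * (D * \<epsilon>) ^ CARD('m)"
    proof (rule mult_right_mono)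
      have "real (card I) \<le> (real (card J))\<^sup>2"
        using cardI by (metis of_nat_le_iff of_nat_power)
      also have "\<dots> \<le> (\<epsilon> powr (- s))\<^sup>2"
        using \<epsilon>(2) J(2) by (intro power_mono) auto
      finally show "real (card I) \<le> (\<epsilon> powr (- s))\<^sup>2" .
    qed (use \<open>0 \<le> D\<close> \<open>0 < \<epsilon>\<close> in auto)
    also have "\<dots> = D ^ CARD('m) * \<epsilon> powr (real CARD('m) - 2 * s)"
      using \<open>0 < \<epsilon>\<close>
      by (simp add: power_mult_distrib powr_realpow[symmetric] powr_powr powr_add[symmetric] power2_eq_square)
    finally show ?thesis using \<epsilon>(3) by simp
  qed
  ultimately show "\<exists>T. ?B \<subseteq> T \<and> T \<in> lmeasurable \<and> measure lebesgue T \<le> e" by blast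
qed

lemma AE_matrix_separates_lipschitz_image:
  fixes f :: "real ^ 'x::finite \<Rightarrow> real ^ 'k::finite"
  assumes "bounded W" "L-lipschitz_on W f" "has_boxdim W k" "2 * k < real CARD('m::finite)"
  shows "AE \<Phi> in (lebesgue :: (real ^ 'k ^ 'm) measure).
           \<forall>a\<in>W. \<forall>b\<in>W. \<Phi> *v f a = \<Phi> *v f b \<longrightarrow> f a = f b"
proof -
  \<comment> \<open>An exponent strictly between \<open>k\<close> and half the number of rows leaves
    room on both sides: for the box count and for the decay in \<epsilon>.\<close>
  obtain s where s: "k < s" "2 * s < real CARD('m)"
    using dense[of k "real CARD('m) / 2"] assms(4) by auto
  \<comment> \<open>One index \<open>n\<close> serves both as entry bound and as separation
    threshold: enlarging it relaxes both conditions, so \<open>max n1 n2\<close> meets them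
    together.\<close>
  define B where "B j n = {\<Phi> :: real ^ 'k ^ 'm. (\<forall>i l. \<bar>\<Phi> $ i $ l\<bar> \<le> real n) \<and>
      (\<exists>a\<in>W. \<exists>b\<in>W. inverse (real (Suc n)) \<le> \<bar>(f a - f b) $ j\<bar> \<and> \<Phi> *v f a = \<Phi> *v f b)}"
    for j n
  have "negligible (B j n)" for j n
    unfolding B_def
    by (rule negligible_collapsing_matrices[OF assms(1,2) _ _ has_boxdim_eventually_le[OF assms(3) s(1)] s(2)])
      auto
  then have "(\<Union>j. \<Union>n. B j n) \<in> null_sets lebesgue"
    by (auto simp: negligible_iff_null_sets intro!: null_sets_UN)
  moreover have "\<Phi> \<in> (\<Union>j. \<Union>n. B j n)"
    if ab: "a \<in> W" "b \<in> W" "\<Phi> *v f a = \<Phi> *v f b" "f a \<noteq> f b" for \<Phi> a b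
  proof -
    obtain j where "(f a - f b) $ j \<noteq> 0"
      using ab(4) by (auto simp: vec_eq_iff)
    then obtain n1 where n1: "inverse (real (Suc n1)) < \<bar>(f a - f b) $ j\<bar>"
      using reals_Archimedean[of "\<bar>(f a - f b) $ j\<bar>"] by auto
    obtain n2 where n2: "norm \<Phi> \<le> real n2"
      using real_arch_simple by blast
    have "inverse (real (Suc (max n1 n2))) \<le> \<bar>(f a - f b) $ j\<bar>"
      using order_trans[OF le_imp_inverse_le less_imp_le[OF n1]] by auto
    moreover have "\<bar>\<Phi> $ i $ l\<bar> \<le> real (max n1 n2)" for i l
      using component_le_norm_cart[of "\<Phi> $ i" l] Finite_Cartesian_Product.norm_nth_le[of \<Phi> i] n2 by linarith
    ultimately have "\<Phi> \<in> B j (max n1 n2)"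
      using ab by (auto simp: B_def)
    then show ?thesis by blast
  qed
  ultimately show ?thesis
    by (intro AE_I') blast+
qed

section \<open>Application to the orbit invariants of tensor powers\<close>

theorem theorem1:
  fixes G :: "('g, 'e) monoid_scheme"
    and \<phi> :: "'g \<Rightarrow> 'x::finite \<Rightarrow> 'x"
    and \<Omega> :: "'k::finite \<Rightarrow> ('x ^ 'w::finite) set"
    and R V :: "(real ^ 'x) set"
    and k :: real
  assumes "group_action G UNIV \<phi>"
    and "finite (carrier G)"
    and "bij_betw \<Omega> UNIV (orbits G UNIV (tuple_act \<phi>))"
    and "fundamental_region G \<phi> R"
    and "bounded V"
    and "discriminable G \<phi> R V (orbit_map \<Omega>)"
    and "has_boxdim (closure (region_reps G \<phi> R V)) k"
    and "CARD('m::finite) < CARD('k)"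
    and "real CARD('m) > 2 * k"
  shows "AE \<Phi> in (lebesgue :: (real ^ 'k ^ 'm) measure).
           discriminable G \<phi> R V (\<lambda>b. \<Phi> *v orbit_map \<Omega> b)"
proof -
  let ?W = "closure (region_reps G \<phi> R V)"
  let ?f = "\<lambda>a. orbit_map \<Omega> (tensor_pow a)"
  have "bounded (region_reps G \<phi> R V)"
    using bounded_vec_act_images[OF assms(5,2)]
    by (rule bounded_subset) (auto simp: region_reps_def)
  then have W: "bounded ?W" by (rule bounded_closure)
  obtain L where "L-lipschitz_on ?W (tensor_pow :: _ \<Rightarrow> real ^ ('x ^ 'w))"
    using lipschitz_on_tensor_pow[OF W] .
  moreover obtain K where "K-lipschitz_on (tensor_pow ` ?W) (orbit_map \<Omega>)"
    using bounded_linear.lipschitz_boundE[OF bounded_linear_orbit_map] .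
  ultimately have "(K * L)-lipschitz_on ?W ?f"
    by (rule lipschitz_on_compose2)
  \<comment> \<open>The separation is obtained on the closure, the set whose dimension is given, and
    is restricted to the representatives by \<open>closure_subset\<close>.\<close>
  from AE_matrix_separates_lipschitz_image[OF W this assms(7), where 'm = 'm]
  have "AE \<Phi> in (lebesgue :: (real ^ 'k ^ 'm) measure).
      \<forall>a\<in>?W. \<forall>b\<in>?W. \<Phi> *v ?f a = \<Phi> *v ?f b \<longrightarrow> ?f a = ?f b"
    using assms(9) by simp
  then show ?thesis
  proof (rule AE_mp, intro AE_I2 impI)
    fix \<Phi> :: "real ^ 'k ^ 'm"
    assume sep: "\<forall>a\<in>?W. \<forall>b\<in>?W. \<Phi> *v ?f a = \<Phi> *v ?f b \<longrightarrow> ?f a = ?f b"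
    show "discriminable G \<phi> R V (\<lambda>b. \<Phi> *v orbit_map \<Omega> b)"
      unfolding discriminable_def
    proof (rule inj_onI)
      fix a b assume ab: "a \<in> region_reps G \<phi> R V" "b \<in> region_reps G \<phi> R V"
        and "\<Phi> *v ?f a = \<Phi> *v ?f b"
      then have "?f a = ?f b"
        using sep closure_subset by blast
      \<comment> \<open>Almost every matrix loses nothing on the image of the invariant; injectivity
        of the invariant itself is the assumed discriminability.\<close>
      then show "a = b"
        using assms(6) ab unfolding discriminable_def by (auto dest: inj_onD)
    qed
  qed
qed

end
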